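(* Let $p$ be a positive integer. For nonnegative integers $a,b$, let $G_b^a$ denote the set of all words in $Y^{\ast}$ which contain $z_p$ exactly $a$ times and $z_{2p}$ exactly $b$ times (and no other letters). Then for any nonnegative integers $m,n$, the following identities hold in $\mathfrak{h}^1$: $$z_p^m \ast z_p^n=\sum_{i=0}^{\min\{m,n\}}\binom{m+n-2i}{m-i}\sum_{w\in G_i^{m+n-2i}}w$$ and $$z_p^m \,\bar{\ast}\, z_p^n=\sum_{i=0}^{\min\{m,n\}}(-1)^i\binom{m+n-2i}{m-i}\sum_{w\in G_i^{m+n-2i}}w.$$
   Context: Let $Y=\{z_k\mid k=1,2,\ldots\}$ be an alphabet of noncommuting letters, $Y^{\ast}$ the set of all words in the letters of $Y$ (including the empty word $1$), and $\mathfrak{h}^1=\mathbb{Q}\langle Y\rangle$ the noncommutative polynomial algebra over $\mathbb{Q}$ generated by $Y$; it has $Y^{\ast}$ as a $\mathbb{Q}$-basis, and juxtaposition denotes the concatenation product, so $z_p^m$ is the word $z_p\cdots z_p$ with $m$ letters ($z_p^0=1$). The two stuffle products $\ast$ and $\bar{\ast}$ are the $\mathbb{Q}$-bilinear products on $\mathfrak{h}^1$ defined recursively by $$1\ast w=w\ast 1=w,\qquad z_kw_1\ast z_lw_2=z_k(w_1\ast z_lw_2)+z_l(z_kw_1\ast w_2)+z_{k+l}(w_1\ast w_2),$$ $$1\,\bar{\ast}\, w=w\,\bar{\ast}\, 1=w,\qquad z_kw_1\,\bar{\ast}\, z_lw_2=z_k(w_1\,\bar{\ast}\, z_lw_2)+z_l(z_kw_1\,\bar{\ast}\,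 w_2)-z_{k+l}(w_1\,\bar{\ast}\, w_2),$$ for all words $w,w_1,w_2\in Y^{\ast}$ and positive integers $k,l$. Both products are commutative and associative. *)

theory Defs
  imports Complex_Main "HOL-Library.Poly_Mapping"
begin

typedef letter = "{k :: nat. 0 < k}"
  morphisms letter_index z_letter
  by auto

text \<open>
  \<^term>\<open>z_letter k\<close> is the letter $z_k$; it is meaningful for \<^prop>\<open>0 < k\<close> only
  (its value at \<^term>\<open>0::nat\<close> is unspecified).
\<close>

lemma letter_index_pos: "0 < letter_index x"
  using letter_index[of x] by simp

lemma letter_index_z_letter [simp]: "0 < k \<Longrightarrow> letter_index (z_letter k) = k"
  by (simp add: z_letter_inverse)

lemma z_letter_inject_iff: "0 < k \<Longrightarrow> 0 < l \<Longrightarrow> z_letter k = z_letter l \<longleftrightarrow> k = l"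
  by (simp add: z_letter_inject)

text \<open>
  Words are lists. With concatenation as the (additively written) monoid operation on lists, the
  convolution product of finitely supported functions on words is the bilinear extension of
  concatenation, so that \<open>letter list \<Rightarrow>\<^sub>0 rat\<close> is the noncommutative polynomial algebra over the
  rationals, as a ring.
\<close>

instantiation list :: (type) monoid_add
begin

definition zero_list :: "'a list" where "0 = []"

definition plus_list :: "'a list \<Rightarrow> 'a list \<Rightarrow> 'a list" where "u + v = u @ v"

instance
  by standard (simp_all add: zero_list_def plus_list_def)

end

type_synonym h1 = "letter list \<Rightarrow>\<^sub>0 rat"

definition word :: "letter list \<Rightarrow> h1" where
  "word w = Poly_Mapping.single w 1"

definition smult :: "rat \<Rightarrow> h1 \<Rightarrow> h1" (infixr "\<cdot>" 75) where
  "c \<cdot> f = Poly_Mapping.map ((*) c) f"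

definition z :: "nat \<Rightarrow> h1" where
  "z k = word [z_letter k]"

definition bilinear_ext :: "(letter list \<Rightarrow> letter list \<Rightarrow> h1) \<Rightarrow> h1 \<Rightarrow> h1 \<Rightarrow> h1" where
  "bilinear_ext B f g =
     (\<Sum>u\<in>Poly_Mapping.keys f. \<Sum>v\<in>Poly_Mapping.keys g.
        (Poly_Mapping.lookup f u * Poly_Mapping.lookup g v) \<cdot> B u v)"

fun stuffle_words :: "letter list \<Rightarrow> letter list \<Rightarrow> h1" where
  "stuffle_words [] w = word w"
| "stuffle_words w [] = word w"
| "stuffle_words (x # u) (y # v) =
     word [x] * stuffle_words u (y # v) + word [y] * stuffle_words (x # u) v
       + z (letter_index x + letter_index y) * stuffle_words u v"

fun stuffle_bar_words :: "letter list \<Rightarrow> letter list \<Rightarrow> h1" where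
  "stuffle_bar_words [] w = word w"
| "stuffle_bar_words w [] = word w"
| "stuffle_bar_words (x # u) (y # v) =
     word [x] * stuffle_bar_words u (y # v) + word [y] * stuffle_bar_words (x # u) v
       - z (letter_index x + letter_index y) * stuffle_bar_words u v"

definition stuffle :: "h1 \<Rightarrow> h1 \<Rightarrow> h1" where
  "stuffle = bilinear_ext stuffle_words"

definition stuffle_bar :: "h1 \<Rightarrow> h1 \<Rightarrow> h1" where
  "stuffle_bar = bilinear_ext stuffle_bar_words"

definition G :: "nat \<Rightarrow> nat \<Rightarrow> nat \<Rightarrow> letter list set" where
  "G p a b = {w. set w \<subseteq> {z_letter p, z_letter (2 * p)} \<and>
     count_list w (z_letter p) = a \<and> count_list w (z_letter (2 * p)) = b}"

lemma word_Nil: "word [] = 1"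
  unfolding word_def by (metis single_one zero_list_def)

lemma word_mult: "word u * word v = word (u @ v)"
  by (simp add: word_def mult_single plus_list_def)

lemma z_power: "z k ^ m = word (replicate m (z_letter k))"
  by (induction m) (simp_all add: word_Nil z_def word_mult)

lemma lookup_smult [simp]:
  "Poly_Mapping.lookup (c \<cdot> f) w = c * Poly_Mapping.lookup f w"
  unfolding smult_def by (simp add: map.rep_eq when_def)

lemma vector_space_smult: "vector_space smult"
  by standard (auto intro!: poly_mapping_eqI simp: lookup_add algebra_simps)

lemma smult_conv_mult: "c \<cdot> f = Poly_Mapping.single 0 c * f"
  unfolding smult_def by (rule mult_map_scale_conv_mult)

lemma smult_mult_left: "(c \<cdot> f) * g = c \<cdot> (f * g)"
  by (simp add: smult_conv_mult mult.assoc)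

lemma bilinear_ext_word: "bilinear_ext B (word u) (word v) = B u v"
  unfolding bilinear_ext_def word_def
  by (simp, rule poly_mapping_eqI, simp)

lemma bilinear_ext_superset:
  assumes "finite S" "finite T" "Poly_Mapping.keys f \<subseteq> S" "Poly_Mapping.keys g \<subseteq> T"
  shows "bilinear_ext B f g =
    (\<Sum>u\<in>S. \<Sum>v\<in>T. (Poly_Mapping.lookup f u * Poly_Mapping.lookup g v) \<cdot> B u v)"
proof -
  interpret vector_space smult by (rule vector_space_smult)
  have "(\<Sum>v\<in>Poly_Mapping.keys g. (Poly_Mapping.lookup f u * Poly_Mapping.lookup g v) \<cdot> B u v)
     = (\<Sum>v\<in>T. (Poly_Mapping.lookup f u * Poly_Mapping.lookup g v) \<cdot> B u v)" for u
    using assms by (intro sum.mono_neutral_left) (auto simp: in_keys_iff)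
  then show ?thesis
    unfolding bilinear_ext_def using assms
    by (simp, intro sum.mono_neutral_left) (auto simp: in_keys_iff)
qed

lemma bilinear_ext_add_left: "bilinear_ext B (f + f') g = bilinear_ext B f g + bilinear_ext B f' g"
proof -
  interpret vector_space smult by (rule vector_space_smult)
  let ?S = "Poly_Mapping.keys f \<union> Poly_Mapping.keys f'"
  have "Poly_Mapping.keys (f + f') \<subseteq> ?S" by (rule keys_add)
  then show ?thesis
    by (simp add: bilinear_ext_superset[of ?S "Poly_Mapping.keys g"] lookup_add
        distrib_right scale_left_distrib sum.distrib)
qed

lemma bilinear_ext_add_right: "bilinear_ext B f (g + g') = bilinear_ext B f g + bilinear_ext B f g'"
proof -
  interpret vector_space smult by (rule vector_space_smult)
  let ?T = "Poly_Mapping.keys g \<union> Poly_Mapping.keys g'"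
  have "Poly_Mapping.keys (g + g') \<subseteq> ?T" by (rule keys_add)
  then show ?thesis
    by (simp add: bilinear_ext_superset[of "Poly_Mapping.keys f" ?T] lookup_add
        distrib_left scale_left_distrib sum.distrib)
qed

lemma bilinear_ext_smult_left: "bilinear_ext B (c \<cdot> f) g = c \<cdot> bilinear_ext B f g"
proof -
  interpret vector_space smult by (rule vector_space_smult)
  have "Poly_Mapping.keys (c \<cdot> f) \<subseteq> Poly_Mapping.keys f" by (auto simp: in_keys_iff)
  then show ?thesis
    by (simp add: bilinear_ext_superset[of "Poly_Mapping.keys f" "Poly_Mapping.keys g"]
        scale_sum_right mult.assoc)
qed

lemma bilinear_ext_smult_right: "bilinear_ext B f (c \<cdot> g) = c \<cdot> bilinear_ext B f g"
proof -
  interpret vector_space smult by (rule vector_space_smult)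
  have "Poly_Mapping.keys (c \<cdot> g) \<subseteq> Poly_Mapping.keys g" by (auto simp: in_keys_iff)
  then show ?thesis
    by (simp add: bilinear_ext_superset[of "Poly_Mapping.keys f" "Poly_Mapping.keys g"]
        scale_sum_right mult_ac)
qed

lemma stuffle_rec:
  assumes "0 < k" "0 < l"
  shows "stuffle (z k * word u) (z l * word v) =
    z k * stuffle (word u) (z l * word v) + z l * stuffle (z k * word u) (word v)
      + z (k + l) * stuffle (word u) (word v)"
  using assms by (simp add: stuffle_def z_def word_mult bilinear_ext_word)

lemma stuffle_bar_rec:
  assumes "0 < k" "0 < l"
  shows "stuffle_bar (z k * word u) (z l * word v) =
    z k * stuffle_bar (word u) (z l * word v) + z l * stuffle_bar (z k * word u) (word v)
      - z (k + l) * stuffle_bar (word u) (word v)"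
  using assms by (simp add: stuffle_bar_def z_def word_mult bilinear_ext_word)

lemma stuffle_unit: "stuffle 1 (word w) = word w" "stuffle (word w) 1 = word w"
  unfolding word_Nil[symmetric] stuffle_def bilinear_ext_word by (simp, cases w, simp_all)

lemma stuffle_bar_unit: "stuffle_bar 1 (word w) = word w" "stuffle_bar (word w) 1 = word w"
  unfolding word_Nil[symmetric] stuffle_bar_def bilinear_ext_word by (simp, cases w, simp_all)

lemma finite_G:
  assumes "0 < p"
  shows "finite (G p a b)"
proof -
  have ne: "z_letter p \<noteq> z_letter (2 * p)"
    using assms by (simp add: z_letter_inject_iff)
  have "length w = count_list w (z_letter p) + count_list w (z_letter (2 * p))"
    if "set w \<subseteq> {z_letter p, z_letter (2 * p)}" for w
    using that ne by (induction w) auto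
  then have "G p a b \<subseteq> {w. set w \<subseteq> {z_letter p, z_letter (2 * p)} \<and> length w = a + b}"
    by (auto simp: G_def)
  then show ?thesis
    by (rule finite_subset) (simp add: finite_lists_length_eq)
qed

end

theory Submission
  imports Defs
begin

text \<open>
  Both products are governed by one recursion, in which merging two letters costs a factor \<open>e\<close>:
  \<open>e = 1\<close> for \<^const>\<open>stuffle\<close> and \<open>e = - 1\<close> for \<^const>\<open>stuffle_bar\<close>. Expanding the recursion, a term of
  the product of \<open>z\<^sub>p\<^sup>m\<close> and \<open>z\<^sub>p\<^sup>n\<close> arises by interleaving the two words while merging some pairs of
  letters, one from each word, into \<open>z\<^sub>2\<^sub>p\<close>. Let \<open>w\<close> be a word in \<open>z\<^sub>p\<close> and \<open>z\<^sub>2\<^sub>p\<close> that contains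
  \<open>z\<^sub>2\<^sub>p\<close> exactly \<open>i\<close> times. Every \<open>z\<^sub>2\<^sub>p\<close> uses up one letter of each factor, hence the word has
  \<open>m + n - 2i\<close> letters \<open>z\<^sub>p\<close>, of which \<open>m - i\<close> come from the left factor. An expansion that yields
  \<open>w\<close> is determined by the choice of these \<open>m - i\<close> letters, and it carries the factor \<open>e\<^sup>i\<close>. So the
  coefficient of \<open>w\<close> is \<open>e\<^sup>i\<close> times a binomial coefficient.

  The formal counterpart of this count is \<open>lookup_merge_recursion\<close>, where the first letter of the
  word decides which summands of the recursion contribute, and where Pascal's rule accounts for
  a first letter \<open>z\<^sub>p\<close>, which may come from either factor. The lemma \<open>merge_recursion_closed_form\<close>
  collects the coefficients.
\<close>

lemma lookup_letter_mult:
  "Poly_Mapping.lookup (word [x] * f) w =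
     (case w of [] \<Rightarrow> 0 | y # v \<Rightarrow> if y = x then Poly_Mapping.lookup f v else 0)"
proof (induction f rule: update_induct)
  case const
  show ?case by (simp split: list.split)
next
  case (update f u c)
  have "Poly_Mapping.update u c f = Poly_Mapping.single u c + f"
    using update.hyps
    by (intro poly_mapping_eqI) (auto simp: lookup_update lookup_add lookup_single in_keys_iff)
  moreover have "Poly_Mapping.lookup (word [x] * Poly_Mapping.single u c) w =
      (case w of [] \<Rightarrow> 0 | y # v \<Rightarrow> if y = x then Poly_Mapping.lookup (Poly_Mapping.single u c) v else 0)"
    by (cases w) (auto simp: word_def mult_single plus_list_def lookup_single when_def)
  ultimately show ?case
    using update.IH by (simp add: distrib_left lookup_add split: list.split)
qed

lemma lookup_word: "Poly_Mapping.lookup (word u) w = (if w = u then 1 else 0)"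
  by (simp add: word_def lookup_single when_def)

lemma lookup_sum_words:
  assumes "finite A"
  shows "Poly_Mapping.lookup (\<Sum>u\<in>A. word u) w = (if w \<in> A then 1 else 0)"
  using assms by (simp add: lookup_sum lookup_word)

lemma eq_replicate_iff_count_list:
  assumes "x \<noteq> y"
  shows "w = replicate n x \<longleftrightarrow> set w \<subseteq> {x, y} \<and> count_list w x = n \<and> count_list w y = 0"
  using assms
proof (induction w arbitrary: n)
  case Nil
  then show ?case by auto
next
  case (Cons a w)
  then show ?case by (cases n) auto
qed

text \<open>
  Induction on the word, because its first letter tells which summands of the recursion can produce
  it. With \<open>i = count_list w y\<close>, the condition \<open>i \<le> m\<close> keeps the truncated difference \<open>m - i\<close>
  meaningful. The symmetric condition \<open>i \<le> n\<close> is encoded in the binomial coefficient: under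
  \<open>count_list w x + 2 * i = m + n\<close>, the inequality \<open>i > n\<close> says that \<open>m - i > count_list w x\<close>.
\<close>

lemma lookup_merge_recursion:
  fixes F :: "nat \<Rightarrow> nat \<Rightarrow> h1" and e :: rat
  assumes "x \<noteq> y"
    and left: "\<And>n. F 0 n = word (replicate n x)"
    and right: "\<And>m. F m 0 = word (replicate m x)"
    and rec: "\<And>m n. F (Suc m) (Suc n) =
      word [x] * F m (Suc n) + word [x] * F (Suc m) n + e \<cdot> (word [y] * F m n)"
  shows "Poly_Mapping.lookup (F m n) w =
    (if set w \<subseteq> {x, y} \<and> count_list w x + 2 * count_list w y = m + n \<and> count_list w y \<le> m
     then e ^ count_list w y * of_nat (count_list w x choose (m - count_list w y)) else 0)"
proof (induction w arbitrary: m n)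
  case Nil
  show ?case
    by (cases m; cases n)
      (simp_all add: left right rec lookup_add lookup_letter_mult lookup_word)
next
  case (Cons a w)
  consider "m = 0" | "n = 0" | m' n' where "m = Suc m'" "n = Suc n'"
    by (cases m; cases n) auto
  then show ?case
  proof cases
    case 1
    then show ?thesis
      using eq_replicate_iff_count_list[OF assms(1), of "a # w" n]
      by (auto simp: left lookup_word)
  next
    case 2
    let ?v = "a # w"
    (* With the right factor empty nothing can be merged; formally, if i = count_list ?v y > 0,
       then m - i exceeds the number m - 2 i of letters x. *)
    have "count_list ?v x choose (m - count_list ?v y) = (if count_list ?v y = 0 then 1 else 0)"
      if "count_list ?v x + 2 * count_list ?v y = m"
      using that by (auto simp: binomial_eq_0_iff simp del: count_list.simps)
    then show ?thesis
      using eq_replicate_iff_count_list[OF assms(1), of ?v m] 2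
      by (auto simp: right lookup_word simp del: count_list.simps set_simps)
  next
    case 3
    have step: "Poly_Mapping.lookup (F m n) (a # w) =
        (if a = x then Poly_Mapping.lookup (F m' n) w + Poly_Mapping.lookup (F m n') w else 0)
        + (if a = y then e * Poly_Mapping.lookup (F m' n') w else 0)"
      using 3 by (simp add: rec lookup_add lookup_letter_mult)
    consider "a = x" | "a = y" | "a \<noteq> x" "a \<noteq> y" by blast
    then show ?thesis
    proof cases
      case 1
      have pascal: "Suc c choose (Suc m' - i) = (c choose (m' - i)) + (c choose (Suc m' - i))"
        if "i \<le> m'" for c i
        using that by (simp add: Suc_diff_le)
      show ?thesis
      proof (cases "count_list w y \<le> m'")
        case True
        then show ?thesis
          using 1 3 assms(1) unfolding step Cons.IH by (simp add: pascal algebra_simps)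
      next
        case False
        then show ?thesis
          using 1 3 assms(1) unfolding step Cons.IH by (auto simp: le_Suc_eq)
      qed
    next
      case 2
      then show ?thesis
        using 3 assms(1) unfolding step Cons.IH by auto
    next
      case 3
      then show ?thesis
        unfolding step by auto
    qed
  qed
qed

lemma merge_recursion_closed_form:
  fixes F :: "nat \<Rightarrow> nat \<Rightarrow> h1" and e :: rat
  assumes "0 < p"
    and "\<And>n. F 0 n = z p ^ n"
    and "\<And>m. F m 0 = z p ^ m"
    and "\<And>m n. F (Suc m) (Suc n) =
      z p * F m (Suc n) + z p * F (Suc m) n + e \<cdot> (z (2 * p) * F m n)"
  shows "F m n = (\<Sum>i = 0..min m n. (e ^ i * of_nat ((m + n - 2 * i) choose (m - i))) \<cdot>
    (\<Sum>w\<in>G p (m + n - 2 * i) i. word w))"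
proof (rule poly_mapping_eqI)
  fix w
  let ?x = "z_letter p" and ?y = "z_letter (2 * p)"
  let ?a = "count_list w ?x" and ?b = "count_list w ?y"
  let ?c = "\<lambda>i. e ^ i * of_nat ((m + n - 2 * i) choose (m - i)) :: rat"
  have ne: "?x \<noteq> ?y"
    using assms(1) by (simp add: z_letter_inject_iff)
  have "?c i * Poly_Mapping.lookup (\<Sum>u\<in>G p (m + n - 2 * i) i. word u) w =
      (if i = ?b then if w \<in> G p (m + n - 2 * i) i then ?c i else 0 else 0)" for i
    unfolding lookup_sum_words[OF finite_G[OF assms(1)]] by (auto simp: G_def)
  then have "Poly_Mapping.lookup (\<Sum>i = 0..min m n. ?c i \<cdot> (\<Sum>u\<in>G p (m + n - 2 * i) i. word u)) w
      = (\<Sum>i = 0..min m n. if i = ?b then if w \<in> G p (m + n - 2 * i) i then ?c i else 0 else 0)"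
    unfolding lookup_sum[of _ "{0..min m n}"] lookup_smult by simp
  also have "\<dots> = (if ?b \<le> min m n \<and> w \<in> G p (m + n - 2 * ?b) ?b then ?c ?b else 0)"
    by simp
  also have "\<dots> = (if set w \<subseteq> {?x, ?y} \<and> ?a + 2 * ?b = m + n \<and> ?b \<le> m
      then e ^ ?b * of_nat (?a choose (m - ?b)) else 0)"
  proof (cases "?b \<le> n")
    case True
    then show ?thesis by (auto simp: G_def)
  next
    case False
    then have "?a choose (m - ?b) = 0" if "?a + 2 * ?b = m + n" "?b \<le> m"
      using that by (simp add: binomial_eq_0_iff)
    with False show ?thesis by auto
  qed
  also have "\<dots> = Poly_Mapping.lookup (F m n) w"
    using lookup_merge_recursion[OF ne, of F e m n w] assms(2-4) unfolding z_power
    by (simp add: z_def)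
  finally show "Poly_Mapping.lookup (F m n) w =
      Poly_Mapping.lookup (\<Sum>i = 0..min m n. ?c i \<cdot> (\<Sum>w\<in>G p (m + n - 2 * i) i. word w)) w"
    by simp
qed

theorem theorem1p1:
  fixes p m n :: nat
  assumes "0 < p"
  shows "stuffle (z p ^ m) (z p ^ n) =
           (\<Sum>i = 0..min m n. of_nat ((m + n - 2 * i) choose (m - i)) \<cdot>
              (\<Sum>w\<in>G p (m + n - 2 * i) i. word w)) \<and>
         stuffle_bar (z p ^ m) (z p ^ n) =
           (\<Sum>i = 0..min m n. ((- 1) ^ i * of_nat ((m + n - 2 * i) choose (m - i))) \<cdot>
              (\<Sum>w\<in>G p (m + n - 2 * i) i. word w))"
proof
  have one: "1 \<cdot> f = f" and minus_one: "(- 1) \<cdot> f = - f" for f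
    by (rule poly_mapping_eqI, simp)+
  have unit: "stuffle 1 (z p ^ k) = z p ^ k" "stuffle (z p ^ k) 1 = z p ^ k"
    "stuffle_bar 1 (z p ^ k) = z p ^ k" "stuffle_bar (z p ^ k) 1 = z p ^ k" for k
    by (simp_all add: z_power stuffle_unit stuffle_bar_unit)
  have "stuffle (z p ^ Suc k) (z p ^ Suc l) = z p * stuffle (z p ^ k) (z p ^ Suc l)
      + z p * stuffle (z p ^ Suc k) (z p ^ l) + 1 \<cdot> (z (2 * p) * stuffle (z p ^ k) (z p ^ l))" for k l
    using stuffle_rec[OF assms assms, of "replicate k (z_letter p)" "replicate l (z_letter p)"]
    by (simp add: one z_power[symmetric] mult_2)
  from merge_recursion_closed_form[OF assms, of "\<lambda>k l. stuffle (z p ^ k) (z p ^ l)", OF _ _ this]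
  show "stuffle (z p ^ m) (z p ^ n) =
      (\<Sum>i = 0..min m n. of_nat ((m + n - 2 * i) choose (m - i)) \<cdot>
        (\<Sum>w\<in>G p (m + n - 2 * i) i. word w))"
    by (simp add: unit)
  have "stuffle_bar (z p ^ Suc k) (z p ^ Suc l) = z p * stuffle_bar (z p ^ k) (z p ^ Suc l)
      + z p * stuffle_bar (z p ^ Suc k) (z p ^ l)
      + (- 1) \<cdot> (z (2 * p) * stuffle_bar (z p ^ k) (z p ^ l))" for k l
    using stuffle_bar_rec[OF assms assms, of "replicate k (z_letter p)" "replicate l (z_letter p)"]
    by (simp add: minus_one z_power[symmetric] mult_2)
  from merge_recursion_closed_form[OF assms, of "\<lambda>k l. stuffle_bar (z p ^ k) (z p ^ l)", OF _ _ this]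
  show "stuffle_bar (z p ^ m) (z p ^ n) =
      (\<Sum>i = 0..min m n. ((- 1) ^ i * of_nat ((m + n - 2 * i) choose (m - i))) \<cdot>
        (\<Sum>w\<in>G p (m + n - 2 * i) i. word w))"
    by (simp add: unit)
qed

end
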